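(* Let $G_1,G_2,G_k$ be generators with event sets $E_1,E_2,E_k$, let $E=E_1\cup E_2\cup E_k$, let $E_u\subseteq E$ be the set of uncontrollable events, and let $K\subseteq L(G_1\|G_2\|G_k)$ be a prefix-closed specification language. Assume that $G_1$ and $G_2$ are conditionally independent given $G_k$ and that $K$ is conditionally decomposable with respect to $(E_{1+k},E_{2+k},E_k)$. Then the supremal (i.e. largest with respect to inclusion) conditionally controllable sublanguage of $K$ always exists and is equal to the union of all conditionally controllable sublanguages of $K$.
   Context: Generators. A generator is $G=(Q,E_G,f,q_0,Q_m)$ with finite state set $Q$, finite event set $E_G$, partial transition function $f:Q\times E_G\to Q$ (extended to words in the usual way), initial state $q_0$, marked states $Q_m\subseteq Q$. Its language is $L(G)=\{s\in E_G^*\mid f(q_0,s)\in Q\}$, i.e. the words on which $f(q_0,\cdot)$ is defined. A language is prefix-closed if it equals the set of all prefixes of its words. Notation. $E_{i+k}=E_i\cup E_k$; $E_{k,u}=E_u\cap E_k$; $E_{i+k,u}=E_u\cap E_{i+k}$. For $A\subseteq B$, the natural projection $B^*\to A^*$ is the monoid morphism erasing the symbols of $B\setminus A$ and fixing those of $A$. $P_k:E^*\to E_k^*$, $P_{i+k}:E^*\to E_{i+k}^*$, and $P^{i+k}_k:E_{i+k}^*\to E_k^*$ are natural projections. For languages $M_j\subseteq A_j^*$ the synchronous product is $\|_j M_j=\bigcap_j Q_j^{-1}(M_j)\subseteq(\bigcup_j A_j)^*$, where $Q_j:(\bigcup_l A_l)^*\to A_j^*$ is the natural projection. The synchronous product of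 generators satisfies $L(G\|G')=L(G)\|L(G')$. Conditional independence. $G_1$ and $G_2$ are conditionally independent given $G_k$ if $E_r(G_1\|G_2)\cap E_r(G_1)\cap E_r(G_2)\subseteq E_r(G_k)$, where $E_r(G)$ is the set of all reachable symbols of $G$ (those occurring in words of $L(G)$). Conditional decomposability. $K$ is conditionally decomposable with respect to $(E_{1+k},E_{2+k},E_k)$ if $K=P_{1+k}(K)\|P_{2+k}(K)\|P_k(K)$. Conditional controllability. A prefix-closed language $M\subseteq L(G_1\|G_2\|G_k)$ is conditionally controllable for $(G_1,G_2,G_k)$ and $(E_{1+k,u},E_{2+k,u},E_{k,u})$ if (i) $P_k(M)E_{k,u}\cap L(G_k)\subseteq P_k(M)$; (ii.a) $P_{1+k}(M)E_{1+k,u}\cap \big(L(G_1)\|P_k(M)\|P_k^{2+k}(L(G_2)\|P_k(M))\big)\subseteq P_{1+k}(M)$; (ii.b) $P_{2+k}(M)E_{2+k,u}\cap \big(L(G_2)\|P_k(M)\|P_k^{1+k}(L(G_1)\|P_k(M))\big)\subseteq P_{2+k}(M)$. A conditionally controllable sublanguage of $K$ is a prefix-closed language $M\subseteq K$ satisfying (i), (ii.a), (ii.b). *)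

theory Defs
  imports Main "HOL-Library.Sublist"
begin

record ('q, 'e) pre_generator =
  states :: "'q set"
  events :: "'e set"
  trans_fun :: "'q \<Rightarrow> 'e \<Rightarrow> 'q option"
  initial :: "'q"
  marked :: "'q set"

text \<open>The partial function \<open>f : Q \<times> E \<rightarrow> Q\<close> is an option-valued function on the whole types that is
  undefined outside \<open>Q \<times> E\<close>.\<close>

locale generator =
  fixes G :: "('q, 'e) pre_generator"
  assumes finite_states: "finite (states G)"
    and finite_events: "finite (events G)"
    and trans_fun_dom_ran:
      "trans_fun G q a = Some q' \<Longrightarrow> q \<in> states G \<and> a \<in> events G \<and> q' \<in> states G"
    and initial_in_states: "initial G \<in> states G"
    and marked_subset: "marked G \<subseteq> states G"

primrec run :: "('q, 'e) pre_generator \<Rightarrow> 'q \<Rightarrow> 'e list \<Rightarrow> 'q option" where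
  "run G q [] = Some q"
| "run G q (a # w) = Option.bind (trans_fun G q a) (\<lambda>q'. run G q' w)"

definition gen_lang :: "('q, 'e) pre_generator \<Rightarrow> 'e list set" where
  "gen_lang G = {s \<in> lists (events G). \<exists>q \<in> states G. run G (initial G) s = Some q}"

definition reachable_symbols :: "('q, 'e) pre_generator \<Rightarrow> 'e set" where
  "reachable_symbols G = (\<Union>s \<in> gen_lang G. set s)"

text \<open>Shared events are executed jointly, private events by one component alone.  The membership
  test only ensures that the transition function is undefined outside the product state set.\<close>

definition sync_gen ::
  "('q1, 'e) pre_generator \<Rightarrow> ('q2, 'e) pre_generator \<Rightarrow> ('q1 \<times> 'q2, 'e) pre_generator"
  (infixl "\<parallel>\<^sub>G" 65) where
  "G \<parallel>\<^sub>G H = \<lparr>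
     states = states G \<times> states H,
     events = events G \<union> events H,
     trans_fun = (\<lambda>(p, q) a.
       if p \<notin> states G \<or> q \<notin> states H then None
       else if a \<in> events G \<and> a \<in> events H then
         (case (trans_fun G p a, trans_fun H q a) of
            (Some p', Some q') \<Rightarrow> Some (p', q') | _ \<Rightarrow> None)
       else if a \<in> events G then map_option (\<lambda>p'. (p', q)) (trans_fun G p a)
       else if a \<in> events H then map_option (\<lambda>q'. (p, q')) (trans_fun H q a)
       else None),
     initial = (initial G, initial H),
     marked = marked G \<times> marked H \<rparr>"

definition prefix_closed :: "'e list set \<Rightarrow> bool" where
  "prefix_closed M \<longleftrightarrow> M = {u. \<exists>w \<in> M. prefix u w}"

text \<open>The natural projection onto words over \<open>A\<close>.  It acts in the same way on all words, so a
  single function serves as \<open>B\<^sup>* \<rightarrow> A\<^sup>*\<close> for every \<open>B \<supseteq> A\<close>.\<close>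

definition proj :: "'e set \<Rightarrow> 'e list \<Rightarrow> 'e list" where
  "proj A w = filter (\<lambda>a. a \<in> A) w"

text \<open>A language \<open>M \<subseteq> A\<^sup>*\<close> enters a synchronous product together with its alphabet, as the pair
  \<open>(A, M)\<close>: the result depends on \<open>A\<close> and not only on the set of words \<open>M\<close>.\<close>

definition sync_alphabet :: "('e set \<times> 'e list set) list \<Rightarrow> 'e set" where
  "sync_alphabet Ms = (\<Union>(A, M) \<in> set Ms. A)"

definition sync_lang :: "('e set \<times> 'e list set) list \<Rightarrow> 'e list set" where
  "sync_lang Ms = {w \<in> lists (sync_alphabet Ms). \<forall>(A, M) \<in> set Ms. proj A w \<in> M}"

definition append_events :: "'e list set \<Rightarrow> 'e set \<Rightarrow> 'e list set" where
  "append_events M A = {s @ [a] | s a. s \<in> M \<and> a \<in> A}"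

definition cond_independent ::
  "('q1, 'e) pre_generator \<Rightarrow> ('q2, 'e) pre_generator \<Rightarrow> ('qk, 'e) pre_generator \<Rightarrow> bool" where
  "cond_independent G1 G2 Gk \<longleftrightarrow>
     reachable_symbols (G1 \<parallel>\<^sub>G G2) \<inter> reachable_symbols G1 \<inter> reachable_symbols G2
       \<subseteq> reachable_symbols Gk"

definition cond_decomposable ::
  "'e list set \<Rightarrow> 'e set \<Rightarrow> 'e set \<Rightarrow> 'e set \<Rightarrow> bool" where
  "cond_decomposable K E1k E2k Ek \<longleftrightarrow>
     K = sync_lang [(E1k, proj E1k ` K), (E2k, proj E2k ` K), (Ek, proj Ek ` K)]"

definition cond_controllable ::
  "('q1, 'e) pre_generator \<Rightarrow> ('q2, 'e) pre_generator \<Rightarrow> ('qk, 'e) pre_generator \<Rightarrow>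
   'e set \<Rightarrow> 'e set \<Rightarrow> 'e set \<Rightarrow> 'e list set \<Rightarrow> bool" where
  "cond_controllable G1 G2 Gk E1ku E2ku Eku M \<longleftrightarrow>
     (let E1 = events G1; E2 = events G2; Ek = events Gk;
          E1k = E1 \<union> Ek; E2k = E2 \<union> Ek;
          Mk = proj Ek ` M; M1k = proj E1k ` M; M2k = proj E2k ` M
      in
        prefix_closed M \<and>
        M \<subseteq> gen_lang (G1 \<parallel>\<^sub>G G2 \<parallel>\<^sub>G Gk) \<and>
        append_events Mk Eku \<inter> gen_lang Gk \<subseteq> Mk \<and>
        append_events M1k E1ku \<inter>
          sync_lang [(E1, gen_lang G1), (Ek, Mk),
                     (Ek, proj Ek ` sync_lang [(E2, gen_lang G2), (Ek, Mk)])]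
          \<subseteq> M1k \<and>
        append_events M2k E2ku \<inter>
          sync_lang [(E2, gen_lang G2), (Ek, Mk),
                     (Ek, proj Ek ` sync_lang [(E1, gen_lang G1), (Ek, Mk)])]
          \<subseteq> M2k)"

definition cond_controllable_sublanguages ::
  "('q1, 'e) pre_generator \<Rightarrow> ('q2, 'e) pre_generator \<Rightarrow> ('qk, 'e) pre_generator \<Rightarrow>
   'e set \<Rightarrow> 'e set \<Rightarrow> 'e set \<Rightarrow> 'e list set \<Rightarrow> 'e list set set" where
  "cond_controllable_sublanguages G1 G2 Gk E1ku E2ku Eku K =
     {M. M \<subseteq> K \<and> cond_controllable G1 G2 Gk E1ku E2ku Eku M}"

text \<open>Supremal in the sense of control theory: a largest element, which has to belong to the
  family, and not merely a least upper bound.\<close>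

definition supremal :: "'e list set set \<Rightarrow> 'e list set \<Rightarrow> bool" where
  "supremal F S \<longleftrightarrow> S \<in> F \<and> (\<forall>M \<in> F. M \<subseteq> S)"

lemma generator_sync_gen:
  assumes "generator G" "generator H"
  shows "generator (G \<parallel>\<^sub>G H)"
proof -
  interpret G: generator G by fact
  interpret H: generator H by fact
  show ?thesis
    using G.finite_states H.finite_states G.finite_events H.finite_events
      G.initial_in_states H.initial_in_states G.marked_subset H.marked_subset
    by unfold_locales
      (auto simp: sync_gen_def split: if_splits option.splits
        dest: G.trans_fun_dom_ran H.trans_fun_dom_ran)
qed

lemma run_sync_gen:
  assumes "generator G" "generator H"
    and "p \<in> states G" "q \<in> states H" "w \<in> lists (events G \<union> events H)"
  shows "run (G \<parallel>\<^sub>G H) (p, q) w = Some (p', q') \<longleftrightarrow>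
    run G p (proj (events G) w) = Some p' \<and> run H q (proj (events H) w) = Some q'"
  using assms(3-5)
proof (induction w arbitrary: p q)
  case Nil
  then show ?case by (auto simp: proj_def)
next
  case (Cons a w)
  note dom = generator.trans_fun_dom_ran[OF assms(1)] generator.trans_fun_dom_ran[OF assms(2)]
  have w: "w \<in> lists (events G \<union> events H)" and a: "a \<in> events G \<union> events H"
    using Cons.prems by auto
  consider "a \<in> events G" "a \<in> events H" | "a \<in> events G" "a \<notin> events H"
    | "a \<notin> events G" "a \<in> events H"
    using a by blast
  then show ?case
  proof cases
    case 1
    show ?thesis
    proof (cases "trans_fun G p a = None \<or> trans_fun H q a = None")
      case True
      then show ?thesis
        using 1 by (auto simp: sync_gen_def proj_def split: option.splits)
    next
      case False
      then obtain p1 q1 where t: "trans_fun G p a = Some p1" "trans_fun H q a = Some q1"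
        by auto
      show ?thesis
        using Cons.IH[of p1 q1] w dom(1)[OF t(1)] dom(2)[OF t(2)] 1 t
        by (simp add: sync_gen_def proj_def)
    qed
  next
    case 2
    show ?thesis
    proof (cases "trans_fun G p a")
      case None
      then show ?thesis using 2 by (simp add: sync_gen_def proj_def)
    next
      case (Some p1)
      then show ?thesis
        using Cons.IH[of p1 q] w dom(1)[OF Some] Cons.prems 2
        by (simp add: sync_gen_def proj_def)
    qed
  next
    case 3
    show ?thesis
    proof (cases "trans_fun H q a")
      case None
      then show ?thesis using 3 by (simp add: sync_gen_def proj_def)
    next
      case (Some q1)
      then show ?thesis
        using Cons.IH[of p q1] w dom(2)[OF Some] Cons.prems 3
        by (simp add: sync_gen_def proj_def)
    qed
  qed
qed

lemma gen_lang_sync_gen: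
  assumes "generator G" "generator H"
  shows "gen_lang (G \<parallel>\<^sub>G H) = sync_lang [(events G, gen_lang G), (events H, gen_lang H)]"
proof -
  have "w \<in> gen_lang (G \<parallel>\<^sub>G H) \<longleftrightarrow>
      w \<in> sync_lang [(events G, gen_lang G), (events H, gen_lang H)]" for w
  proof (cases "w \<in> lists (events G \<union> events H)")
    case True
    have "proj (events G) w \<in> lists (events G)" "proj (events H) w \<in> lists (events H)"
      by (auto simp: proj_def)
    moreover have "gen_lang (G \<parallel>\<^sub>G H) = {s \<in> lists (events G \<union> events H).
        \<exists>p \<in> states G. \<exists>q \<in> states H. run (G \<parallel>\<^sub>G H) (initial G, initial H) s = Some (p, q)}"
      by (auto simp: gen_lang_def) (auto simp: sync_gen_def)
    ultimately show ?thesis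
      using True run_sync_gen[OF assms generator.initial_in_states[OF assms(1)]
          generator.initial_in_states[OF assms(2)] True]
      by (auto simp: sync_lang_def sync_alphabet_def gen_lang_def)
  next
    case False
    then show ?thesis
      by (auto simp: gen_lang_def sync_lang_def sync_alphabet_def sync_gen_def)
  qed
  then show ?thesis by blast
qed

end

theory Submission
  imports Defs
begin

text \<open>Only condition (ii) needs an argument: the word \<open>s @ [a]\<close> may have its projection onto
  \<open>E\<^sub>k\<close> witnessed by another member of the family than \<open>s\<close>.  If \<open>a \<notin> E\<^sub>k\<close>, the projections of
  \<open>s @ [a]\<close> and \<open>s\<close> agree; if \<open>a \<in> E\<^sub>k\<close>, then \<open>a\<close> is an uncontrollable event of \<open>G\<^sub>k\<close>, and (i) for
  the member containing \<open>s\<close> extends its projection by \<open>a\<close>.\<close>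

lemma prefix_closed_Union:
  assumes "\<And>M. M \<in> F \<Longrightarrow> prefix_closed M"
  shows "prefix_closed (\<Union>F)"
  using assms unfolding prefix_closed_def by blast

lemma append_events_proj_Union:
  "append_events (proj A ` \<Union>F) B = (\<Union>M\<in>F. append_events (proj A ` M) B)"
  unfolding append_events_def by blast

lemma proj_snoc: "proj A (s @ [a]) = (if a \<in> A then proj A s @ [a] else proj A s)"
  by (simp add: proj_def)

lemma proj_proj_subset: "A \<subseteq> B \<Longrightarrow> proj A (proj B w) = proj A w"
  unfolding proj_def by (simp add: filter_filter) (meson subsetD)

text \<open>The inner constraint \<open>proj Ek t \<in> N\<close> is absorbed: \<open>t\<close> has
  the same projection onto \<open>Ek\<close> as \<open>w\<close>, which already lies in
  \<open>N\<close>. Hence \<open>N\<close> enters only through \<open>proj Ek w\<close>, and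
  exchanging one \<open>N\<close> for another means checking that single word.\<close>

lemma mem_sync_with_proj_iff:
  "w \<in> sync_lang [(E1, L1), (Ek, N), (Ek, proj Ek ` sync_lang [(E2, L2), (Ek, N)])] \<longleftrightarrow>
    w \<in> lists (E1 \<union> Ek) \<and> proj E1 w \<in> L1 \<and> proj Ek w \<in> N \<and>
    (\<exists>t \<in> lists (E2 \<union> Ek). proj E2 t \<in> L2 \<and> proj Ek t = proj Ek w)"
  by (auto simp: sync_lang_def sync_alphabet_def image_iff)

text \<open>Used with \<open>H = Gk\<close>: it places the coordinator projections of all members in
  the language of \<open>Gk\<close>, as needed to apply (i).\<close>

lemma proj_sync_gen_subset:
  assumes "generator G" "generator H" and "M \<subseteq> gen_lang (G \<parallel>\<^sub>G H)"
  shows "proj (events H) ` M \<subseteq> gen_lang H"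
  using assms(3) unfolding gen_lang_sync_gen[OF assms(1,2)]
  by (auto simp: sync_lang_def)

text \<open>The index pairs are kept abstract so that (ii.a) and (ii.b) are both instances, with the
  roles of 1 and 2 exchanged.\<close>

lemma cond_controllable_step_Union:
  assumes coord: "\<And>M. M \<in> F \<Longrightarrow> proj Ek ` M \<subseteq> Lk"
    and coord_ctrl: "\<And>M. M \<in> F \<Longrightarrow>
      append_events (proj Ek ` M) (Eu \<inter> Ek) \<inter> Lk \<subseteq> proj Ek ` M"
    and ctrl: "\<And>M. M \<in> F \<Longrightarrow>
      append_events (proj (E1 \<union> Ek) ` M) (Eu \<inter> (E1 \<union> Ek)) \<inter>
        sync_lang [(E1, L1), (Ek, proj Ek ` M),
                   (Ek, proj Ek ` sync_lang [(E2, L2), (Ek, proj Ek ` M)])]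
        \<subseteq> proj (E1 \<union> Ek) ` M"
  shows "append_events (proj (E1 \<union> Ek) ` \<Union>F) (Eu \<inter> (E1 \<union> Ek)) \<inter>
        sync_lang [(E1, L1), (Ek, proj Ek ` \<Union>F),
                   (Ek, proj Ek ` sync_lang [(E2, L2), (Ek, proj Ek ` \<Union>F)])]
        \<subseteq> proj (E1 \<union> Ek) ` \<Union>F"
proof
  fix w
  assume w: "w \<in> append_events (proj (E1 \<union> Ek) ` \<Union>F) (Eu \<inter> (E1 \<union> Ek)) \<inter>
        sync_lang [(E1, L1), (Ek, proj Ek ` \<Union>F),
                   (Ek, proj Ek ` sync_lang [(E2, L2), (Ek, proj Ek ` \<Union>F)])]"
  then obtain v a M where M: "M \<in> F" "v \<in> M" and a: "a \<in> Eu \<inter> (E1 \<union> Ek)"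
    and w_eq: "w = proj (E1 \<union> Ek) v @ [a]"
    unfolding append_events_def by blast
  have sync: "w \<in> lists (E1 \<union> Ek)" "proj E1 w \<in> L1" "proj Ek w \<in> proj Ek ` \<Union>F"
    "\<exists>t \<in> lists (E2 \<union> Ek). proj E2 t \<in> L2 \<and> proj Ek t = proj Ek w"
    using w by (simp_all only: Int_iff mem_sync_with_proj_iff)
  have proj_w: "proj Ek w = (if a \<in> Ek then proj Ek v @ [a] else proj Ek v)"
    by (simp add: w_eq proj_snoc proj_proj_subset)
  \<comment> \<open>Here \<open>M\<close> is the member that supplies the prefix \<open>v\<close>,
    whereas \<open>sync(3)\<close> only gives some member of \<open>F\<close>. Once this is shown,
    \<Union>F can be replaced by \<open>M\<close> in the synchronous product.\<close>
  have "proj Ek w \<in> proj Ek ` M"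
  proof (cases "a \<in> Ek")
    case True
    then have "proj Ek w \<in> append_events (proj Ek ` M) (Eu \<inter> Ek)"
      using M a proj_w unfolding append_events_def by auto
    \<comment> \<open>The possibly different member behind \<open>sync(3)\<close> is used only to
      bound the word by \<open>Lk\<close>.\<close>
    moreover have "proj Ek w \<in> Lk" using sync(3) coord by blast
    ultimately show ?thesis using coord_ctrl[OF M(1)] by blast
  next
    case False
    then show ?thesis using M proj_w by simp
  qed
  with sync have "w \<in> sync_lang [(E1, L1), (Ek, proj Ek ` M),
      (Ek, proj Ek ` sync_lang [(E2, L2), (Ek, proj Ek ` M)])]"
    by (simp only: mem_sync_with_proj_iff simp_thms)
  moreover have "w \<in> append_events (proj (E1 \<union> Ek) ` M) (Eu \<inter> (E1 \<union> Ek))"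
    using M a w_eq unfolding append_events_def by blast
  ultimately show "w \<in> proj (E1 \<union> Ek) ` \<Union>F"
    using ctrl[OF M(1)] M(1) by blast
qed

lemma cond_controllable_Union:
  fixes Eu :: "'e set"
  assumes gens: "generator G1" "generator G2" "generator Gk"
    and cc: "\<And>M. M \<in> F \<Longrightarrow> cond_controllable G1 G2 Gk (Eu \<inter> (events G1 \<union> events Gk))
      (Eu \<inter> (events G2 \<union> events Gk)) (Eu \<inter> events Gk) M"
  shows "cond_controllable G1 G2 Gk (Eu \<inter> (events G1 \<union> events Gk))
      (Eu \<inter> (events G2 \<union> events Gk)) (Eu \<inter> events Gk) (\<Union>F)"
proof -
  note cc' = cc[unfolded cond_controllable_def Let_def]
  have sub: "M \<subseteq> gen_lang (G1 \<parallel>\<^sub>G G2 \<parallel>\<^sub>G Gk)" if "M \<in> F" for M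
    using cc'[OF that] by blast
  have coord: "proj (events Gk) ` M \<subseteq> gen_lang Gk" if "M \<in> F" for M
    using proj_sync_gen_subset[OF generator_sync_gen[OF gens(1,2)] gens(3) sub[OF that]] .
  have coord_ctrl: "append_events (proj (events Gk) ` M) (Eu \<inter> events Gk) \<inter> gen_lang Gk
      \<subseteq> proj (events Gk) ` M" if "M \<in> F" for M
    using cc'[OF that] by blast
  \<comment> \<open>The bound in (i) does not vary with the member, so (i) passes to the union one
    member at a time. The bound in (ii) grows with the member.\<close>
  have "append_events (proj (events Gk) ` \<Union>F) (Eu \<inter> events Gk) \<inter> gen_lang Gk
      \<subseteq> proj (events Gk) ` \<Union>F"
    unfolding append_events_proj_Union using coord_ctrl by blast
  moreover have "prefix_closed (\<Union>F)"
    using cc' by (intro prefix_closed_Union) blast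
  moreover have "\<Union>F \<subseteq> gen_lang (G1 \<parallel>\<^sub>G G2 \<parallel>\<^sub>G Gk)"
    using sub by blast
  ultimately show ?thesis
    unfolding cond_controllable_def Let_def
    using cc'
      cond_controllable_step_Union[where F = F and Ek = "events Gk" and Eu = Eu
        and ?E1.0 = "events G1" and ?L1.0 = "gen_lang G1"
        and ?E2.0 = "events G2" and ?L2.0 = "gen_lang G2", OF coord coord_ctrl]
      cond_controllable_step_Union[where F = F and Ek = "events Gk" and Eu = Eu
        and ?E1.0 = "events G2" and ?L1.0 = "gen_lang G2"
        and ?E2.0 = "events G1" and ?L2.0 = "gen_lang G1", OF coord coord_ctrl]
    by (intro conjI) blast+
qed

theorem theorem12:
  fixes G1 :: "('q1, 'e) pre_generator"
    and G2 :: "('q2, 'e) pre_generator"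
    and Gk :: "('qk, 'e) pre_generator"
    and E1 E2 Ek Eu :: "'e set"
    and K :: "'e list set"
  assumes "generator G1" and "generator G2" and "generator Gk"
    and "E1 = events G1" and "E2 = events G2" and "Ek = events Gk"
    and "Eu \<subseteq> E1 \<union> E2 \<union> Ek"
    and "K \<subseteq> gen_lang (G1 \<parallel>\<^sub>G G2 \<parallel>\<^sub>G Gk)" and "prefix_closed K"
    and "cond_independent G1 G2 Gk"
    and "cond_decomposable K (E1 \<union> Ek) (E2 \<union> Ek) Ek"
  defines "CC \<equiv> cond_controllable_sublanguages G1 G2 Gk
                  (Eu \<inter> (E1 \<union> Ek)) (Eu \<inter> (E2 \<union> Ek)) (Eu \<inter> Ek) K"
  shows "\<exists>S. supremal CC S \<and> S = \<Union> CC"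
proof -
  \<comment> \<open>Closure under arbitrary unions puts the union into the family itself; it is then
    trivially largest.\<close>
  have "\<Union>CC \<in> CC"
    using cond_controllable_Union[OF assms(1-3), of CC Eu]
    unfolding CC_def cond_controllable_sublanguages_def assms(4-6)
    by blast
  then show ?thesis
    unfolding supremal_def by blast
qed

end
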